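(* Let $\Omega\in\mathbb R$ and $\mathbf k\in\mathbb Z^3\setminus\{\mathbf 0\}$. Suppose $u_0=\mathbf U_0+w_0$, where $\mathbf U_0$ is a constant vector in $\mathbb R^3$ and $$w_0=\sum_{m\in\mathbb Z_*}\widehat{\mathbf u}_{0,m\mathbf k}e^{im\check{\mathbf k}\cdot\mathbf x}\in V_{\mathbf k}.$$ Let $\mathbf U(t)=e^{-\Omega tJ}\mathbf U_0$ and $\mathbf V(t)=\int_0^t\mathbf U(\tau)\,d\tau$. Define, for $\mathbf x\in\mathbb R^3$ and $t>0$, $$\mathbf u(\mathbf x,t)=\mathbf U(t)+\sum_{m\in\mathbb Z_*}e^{-m^2|\check{\mathbf k}|^2t}e^{-im\check{\mathbf k}\cdot\mathbf V(t)}E_{\mathbf k}(-\widetilde k_3\Omega t)\widehat{\mathbf u}_{0,m\mathbf k}e^{im\check{\mathbf k}\cdot\mathbf x},$$ $$p(\mathbf x,t)=p_*(t)-\Omega\sum_{m\in\mathbb Z_*}\frac{i}{m|\check{\mathbf k}|}e^{-m^2|\check{\mathbf k}|^2t}e^{-im\check{\mathbf k}\cdot\mathbf V(t)}\Big(\big[\cos(\widetilde k_3\Omega t)J\widetilde{\mathbf k}+\sin(\widetilde k_3\Omega t)\mathbf e_3\big]\cdot\widehat{\mathbf u}_{0,m\mathbf k}\Big)e^{im\check{\mathbf k}\cdot\mathbf x},$$ where $p_*(t)$ is any scalar function. Then $(\mathbf u,p)$ is a solution of $$\frac{\partial\mathbf u}{\partial t}-\Delta\mathbf u+(\mathbf u\cdot\nabla)\mathbf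 u+\nabla p+\Omega J\mathbf u=0,\qquad{\rm div}\,\mathbf u=0$$ on $\mathbb R^3\times(0,\infty)$.
   Context: Let $L_1,L_2,L_3>0$ with $\max\{L_1,L_2,L_3\}=2\pi$. $\mathbb Z_*=\mathbb Z\setminus\{0\}$. For $\mathbf k=(k_1,k_2,k_3)\in\mathbb Z^3\setminus\{\mathbf0\}$, $\check{\mathbf k}=2\pi(k_1/L_1,k_2/L_2,k_3/L_3)$ and $\widetilde{\mathbf k}=(\widetilde k_1,\widetilde k_2,\widetilde k_3)=\check{\mathbf k}/|\check{\mathbf k}|$. The dot product on $\mathbb C^3$ is bilinear: $\mathbf x\cdot\mathbf y=\mathbf x^{\rm T}\mathbf y$. $J$ is the $3\times3$ matrix with $J\mathbf z=\mathbf e_3\times\mathbf z$; $J_{\mathbf k}$ is the $3\times3$ matrix with $J_{\mathbf k}\mathbf z=\widetilde{\mathbf k}\times\mathbf z$; $E_{\mathbf k}(t)=\cos(t)I_3+\sin(t)J_{\mathbf k}$. $V_{\mathbf k}$ is the space of all real (i.e. $\widehat{\mathbf u}_{-m\mathbf k}=\overline{\widehat{\mathbf u}_{m\mathbf k}}$), divergence-free (i.e. $\widehat{\mathbf u}_{m\mathbf k}\cdot\check{\mathbf k}=0$) vector fields $u=\sum_{m\in\mathbb Z_*}\widehat{\mathbf u}_{m\mathbf k}e^{im\check{\mathbf k}\cdot\mathbf x}$, with $\widehat{\mathbf u}_{m\mathbf k}\in\mathbb C^3$, belonging to $H^1$ of the torus $(\mathbb R/L_1\mathbb Z)\times(\mathbb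 R/L_2\mathbb Z)\times(\mathbb R/L_3\mathbb Z)$ (i.e. $\sum_m m^2|\widehat{\mathbf u}_{m\mathbf k}|^2<\infty$). "Solution" is meant in the classical pointwise sense. *)

theory Defs
  imports "HOL-Analysis.Analysis"
begin

definition cvec :: "real^'n \<Rightarrow> complex^'n" where
  "cvec v = (\<chi> i. complex_of_real (v $ i))"

definition cvec_cnj :: "complex^'n \<Rightarrow> complex^'n" where
  "cvec_cnj v = (\<chi> i. cnj (v $ i))"

definition cvec_Re :: "complex^'n \<Rightarrow> real^'n" where
  "cvec_Re v = (\<chi> i. Re (v $ i))"

(* The bilinear dot product; inner on complex^'n is real valued and not C-bilinear. *)
definition cdot :: "complex^'n \<Rightarrow> complex^'n \<Rightarrow> complex" (infix \<open>\<bullet>\<^sub>c\<close> 70) where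
  "x \<bullet>\<^sub>c y = (\<Sum>i\<in>UNIV. x $ i * y $ i)"

fun mat_power :: "real^'n^'n \<Rightarrow> nat \<Rightarrow> real^'n^'n" where
  "mat_power A 0 = mat 1"
| "mat_power A (Suc n) = A ** mat_power A n"

(* The library's exp does not apply here: the built-in multiplication on vectors and
   matrices is componentwise. *)
definition mat_exp :: "real^'n^'n \<Rightarrow> real^'n^'n" where
  "mat_exp A = (\<Sum>n. mat_power A n /\<^sub>R fact n)"

definition J :: "real^3^3" where
  "J = matrix (cross3 (axis 3 1))"

definition kcheck :: "real^3 \<Rightarrow> int^3 \<Rightarrow> real^3" where
  "kcheck L k = (\<chi> i. 2 * pi * (real_of_int (k $ i) / L $ i))"

definition ktilde :: "real^3 \<Rightarrow> int^3 \<Rightarrow> real^3" where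
  "ktilde L k = kcheck L k /\<^sub>R norm (kcheck L k)"

definition Jk :: "real^3 \<Rightarrow> int^3 \<Rightarrow> real^3^3" where
  "Jk L k = matrix (cross3 (ktilde L k))"

definition Ek :: "real^3 \<Rightarrow> int^3 \<Rightarrow> real \<Rightarrow> real^3^3" where
  "Ek L k t = cos t *\<^sub>R mat 1 + sin t *\<^sub>R Jk L k"

abbreviation Zstar :: "int set" where
  "Zstar \<equiv> - {0}"

definition wave :: "real^3 \<Rightarrow> int^3 \<Rightarrow> int \<Rightarrow> real^3 \<Rightarrow> complex" where
  "wave L k m x = exp (\<i> * of_int m * complex_of_real (kcheck L k \<bullet> x))"

(* w belongs to V_k and a m is its Fourier coefficient at the frequency m k, m nonzero
   (a 0 plays no role).  The H^1 condition makes the series absolutely convergent, so the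
   expansion is required pointwise: w is the continuous representative. *)
definition Vk_expansion ::
    "real^3 \<Rightarrow> int^3 \<Rightarrow> (int \<Rightarrow> complex^3) \<Rightarrow> (real^3 \<Rightarrow> real^3) \<Rightarrow> bool" where
  "Vk_expansion L k a w \<longleftrightarrow>
     (\<forall>m\<in>Zstar. a (- m) = cvec_cnj (a m)) \<and>
     (\<forall>m\<in>Zstar. a m \<bullet>\<^sub>c cvec (kcheck L k) = 0) \<and>
     (\<lambda>m. (real_of_int m)\<^sup>2 * (norm (a m))\<^sup>2) summable_on Zstar \<and>
     (\<forall>x. ((\<lambda>m. wave L k m x *s a m) has_sum cvec (w x)) Zstar)"

definition Vk :: "real^3 \<Rightarrow> int^3 \<Rightarrow> (real^3 \<Rightarrow> real^3) set" where
  "Vk L k = {w. \<exists>a. Vk_expansion L k a w}"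

definition partial :: "'n \<Rightarrow> (real^'n \<Rightarrow> 'b::real_normed_vector) \<Rightarrow> real^'n \<Rightarrow> 'b" where
  "partial j f x = frechet_derivative f (at x) (axis j 1)"

definition gradient :: "(real^'n \<Rightarrow> real) \<Rightarrow> real^'n \<Rightarrow> real^'n" where
  "gradient f x = (\<chi> j. partial j f x)"

definition laplacian :: "(real^'n \<Rightarrow> 'b::real_normed_vector) \<Rightarrow> real^'n \<Rightarrow> 'b" where
  "laplacian f x = (\<Sum>j\<in>UNIV. partial j (partial j f) x)"

definition divergence :: "(real^'n \<Rightarrow> real^'n) \<Rightarrow> real^'n \<Rightarrow> real" where
  "divergence f x = (\<Sum>j\<in>UNIV. partial j f x $ j)"

definition advection ::
    "(real^'n \<Rightarrow> real^'n) \<Rightarrow> (real^'n \<Rightarrow> 'b::real_normed_vector) \<Rightarrow> real^'n \<Rightarrow> 'b" where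
  "advection v f x = (\<Sum>j\<in>UNIV. v x $ j *\<^sub>R partial j f x)"

(* No regularity of p in time is demanded, since p may contain an arbitrary function of t. *)
definition classical_regularity ::
    "(real^3 \<Rightarrow> real \<Rightarrow> real^3) \<Rightarrow> (real^3 \<Rightarrow> real \<Rightarrow> real) \<Rightarrow> bool" where
  "classical_regularity u p \<longleftrightarrow>
     (\<forall>x. \<forall>t>0. (\<lambda>s. u x s) differentiable (at t)) \<and>
     (\<forall>x. \<forall>t>0. (\<lambda>y. u y t) differentiable (at x)) \<and>
     (\<forall>x. \<forall>t>0. \<forall>j. partial j (\<lambda>y. u y t) differentiable (at x)) \<and>
     (\<forall>x. \<forall>t>0. (\<lambda>y. p y t) differentiable (at x)) \<and>
     continuous_on (UNIV \<times> {0<..}) (\<lambda>(x, t). u x t) \<and>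
     continuous_on (UNIV \<times> {0<..}) (\<lambda>(x, t). vector_derivative (\<lambda>s. u x s) (at t)) \<and>
     (\<forall>j. continuous_on (UNIV \<times> {0<..}) (\<lambda>(x, t). partial j (\<lambda>y. u y t) x)) \<and>
     (\<forall>i j. continuous_on (UNIV \<times> {0<..}) (\<lambda>(x, t). partial i (partial j (\<lambda>y. u y t)) x)) \<and>
     continuous_on (UNIV \<times> {0<..}) (\<lambda>(x, t). gradient (\<lambda>y. p y t) x)"

definition classical_solution ::
    "real \<Rightarrow> (real^3 \<Rightarrow> real \<Rightarrow> real^3) \<Rightarrow> (real^3 \<Rightarrow> real \<Rightarrow> real) \<Rightarrow> bool" where
  "classical_solution \<Omega> u p \<longleftrightarrow>
     classical_regularity u p \<and>
     (\<forall>x. \<forall>t>0.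
        vector_derivative (\<lambda>s. u x s) (at t) - laplacian (\<lambda>y. u y t) x
        + advection (\<lambda>y. u y t) (\<lambda>y. u y t) x
        + gradient (\<lambda>y. p y t) x + \<Omega> *\<^sub>R (J *v u x t) = 0 \<and>
        divergence (\<lambda>y. u y t) x = 0)"

end

theory Submission
  imports Defs "HOL-Real_Asymp.Real_Asymp"
begin

text \<open>With \<open>r\<close> the length and \<open>a\<close> the direction of the wave vector \<open>K = r a\<close>, the velocity is
  \<open>U(t) + R(t) W(K \<bullet> (x - V(t)), t)\<close>, where \<open>W(s, t)\<close> is a real Fourier series with values in the
  plane orthogonal to \<open>a\<close> that solves \<open>W\<^sub>t = r\<^sup>2 W\<^sub>s\<^sub>s\<close>, and \<open>R(t)\<close> is the rotation about \<open>a\<close> by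
  \<open>- a\<^sub>3 \<Omega> t\<close>.  The wave is transverse, so the advection term reduces to transport by \<open>U\<close>, which
  the moving phase cancels; the Laplacian cancels against the heat equation.  For \<open>z\<close> orthogonal
  to \<open>a\<close>, the Coriolis term \<open>e\<^sub>3 \<times> z\<close> splits into \<open>a\<^sub>3 (a \<times> z)\<close>, which the derivative of \<open>R\<close>
  cancels, and a multiple of \<open>a\<close>, which is the pressure gradient.  Gaussian decay of the
  coefficients for \<open>t > 0\<close> justifies all termwise differentiations.\<close>

section \<open>Rotation of the mean flow\<close>

lemma matrix_diff_ldistrib: "A ** (B - C) = A ** B - A ** C" for A :: "'a::ring_1^'n^'m"
  by (simp add: matrix_matrix_mult_def vec_eq_iff right_diff_distrib sum_subtractf)

lemma J_cube: "J ** (J ** J) = - J"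
  by (simp add: J_def matrix_def cross3_simps matrix_matrix_mult_def axis_def forall_3)

lemma mat_power_scaleR: "mat_power (c *\<^sub>R A) n = c ^ n *\<^sub>R mat_power A n"
  by (induction n) (simp_all add: scalar_matrix_assoc[symmetric] matrix_scalar_ac)

text \<open>Since \<open>J\<close> cubed is \<open>- J\<close>, the powers from the first on cycle
  through J, J^2, -J, -J^2: odd exponents carry the sine coefficients and even ones minus the cosine
  coefficients of J^2. Exponent 0 breaks the pattern, as the identity replaces -J^2; the term
  present only at \<open>n = 0\<close> corrects this.\<close>

lemma mat_power_J_over_fact:
  "mat_power J n /\<^sub>R fact n =
     (if n = 0 then mat 1 + J ** J else 0) + sin_coeff n *\<^sub>R J - cos_coeff n *\<^sub>R (J ** J)"
proof (induction n)
  case (Suc n)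
  have "mat_power J (Suc n) /\<^sub>R fact (Suc n) = (J ** (mat_power J n /\<^sub>R fact n)) /\<^sub>R real (Suc n)"
    by (simp add: matrix_scalar_ac scalar_matrix_assoc[symmetric] field_simps del: of_nat_Suc)
  \<comment> \<open>The correction term disappears after one multiplication, because J (1 + J^2) = J
    + J^3 = 0.\<close>
  also have "J ** (mat_power J n /\<^sub>R fact n) = cos_coeff n *\<^sub>R J + sin_coeff n *\<^sub>R (J ** J)"
    unfolding Suc.IH
    by (auto simp: matrix_add_ldistrib matrix_diff_ldistrib matrix_scalar_ac J_cube simp flip: scalar_matrix_assoc)
  finally show ?case
    by (simp add: sin_coeff_Suc cos_coeff_Suc divide_inverse algebra_simps del: of_nat_Suc)
qed simp

text \<open>Rodrigues' formula for the rotation about the third axis, obtained by summing the three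
  kinds of terms of the exponential series separately.\<close>

lemma mat_exp_scaleR_J: "mat_exp (s *\<^sub>R J) = mat 1 + J ** J + sin s *\<^sub>R J - cos s *\<^sub>R (J ** J)"
proof -
  have "(\<lambda>n. (if n = 0 then mat 1 + J ** J else 0) + (sin_coeff n *\<^sub>R s ^ n) *\<^sub>R J
            - (cos_coeff n *\<^sub>R s ^ n) *\<^sub>R (J ** J))
        sums (mat 1 + J ** J + sin s *\<^sub>R J - cos s *\<^sub>R (J ** J))"
    using sums_single[of 0 "\<lambda>_. mat 1 + J ** J"]
    by (intro sums_add sums_diff sums_scaleR_left sin_converges cos_converges) simp
  also have "(\<lambda>n. (if n = 0 then mat 1 + J ** J else 0) + (sin_coeff n *\<^sub>R s ^ n) *\<^sub>R J
            - (cos_coeff n *\<^sub>R s ^ n) *\<^sub>R (J ** J)) = (\<lambda>n. mat_power (s *\<^sub>R J) n /\<^sub>R fact n)"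
  proof
    fix n
    have "mat_power (s *\<^sub>R J) n /\<^sub>R fact n = s ^ n *\<^sub>R (mat_power J n /\<^sub>R fact n)"
      by (simp add: mat_power_scaleR)
    then show "(if n = 0 then mat 1 + J ** J else 0) + (sin_coeff n *\<^sub>R s ^ n) *\<^sub>R J
            - (cos_coeff n *\<^sub>R s ^ n) *\<^sub>R (J ** J) = mat_power (s *\<^sub>R J) n /\<^sub>R fact n"
      by (simp add: mat_power_J_over_fact algebra_simps)
  qed
  finally show ?thesis
    unfolding mat_exp_def by (simp add: sums_iff)
qed

lemma rotation_has_vector_derivative:
  "((\<lambda>t. mat_exp ((- (\<Omega> * t)) *\<^sub>R J) *v U0)
     has_vector_derivative - \<Omega> *\<^sub>R (J *v (mat_exp ((- (\<Omega> * t)) *\<^sub>R J) *v U0))) (at t)"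
proof -
  let ?JU = "J *v U0" and ?JJU = "J *v (J *v U0)"
  have eq: "mat_exp ((- (\<Omega> * t)) *\<^sub>R J) *v U0
      = U0 + ?JJU - sin (\<Omega> * t) *\<^sub>R ?JU - cos (\<Omega> * t) *\<^sub>R ?JJU" for t
    unfolding mat_exp_scaleR_J
    by (simp add: matrix_vector_mult_add_rdistrib matrix_vector_mult_diff_rdistrib
        matrix_vector_mul_assoc scaleR_matrix_vector_assoc[symmetric])
  have J3: "J *v ?JJU = - ?JU"
    by (simp add: matrix_vector_mul_assoc J_cube) (simp add: matrix_vector_mult_def vec_eq_iff sum_negf)
  show ?thesis
    unfolding eq has_vector_derivative_def
    by (rule derivative_eq_intros refl | rule ext)+
      (simp add: matrix_vector_mult_diff_distrib matrix_vector_right_distrib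
        matrix_vector_mult_scaleR J3 algebra_simps)
qed

section \<open>Fourier series solving the heat equation\<close>

lemma norm_vector_smult: "norm (c *s (v :: complex^'n)) = norm c * norm v"
  by (simp add: norm_vec_def norm_mult L2_set_right_distrib)

lemma scaleR_vector_smult: "r *\<^sub>R (c *s v) = (complex_of_real r * c) *s v"
  by (simp add: vec_eq_iff flip: scaleR_conv_of_real)

lemma bounded_linear_vector_smult_left: "bounded_linear (\<lambda>c. c *s (v :: complex^'n))"
  by (rule bounded_linear_intro[where K = "norm v"])
    (simp_all add: norm_vector_smult vec_eq_iff algebra_simps)

text \<open>Absolute summability allows the sum to be read along any enumeration of
  \<open>I\<close>, where termwise differentiation of ordinary series applies: the majorant
  \<open>M\<close> makes the series of derivatives converge uniformly on the convex set
  \<open>S\<close>. Openness of \<open>S\<close> finally turns the derivative within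
  \<open>S\<close> into a full one.\<close>

lemma has_derivative_infsum:
  fixes f :: "'i \<Rightarrow> 'a::real_normed_vector \<Rightarrow> 'b::banach"
  assumes I: "countable I" "infinite I" and S: "open S" "convex S" and x: "x \<in> S"
    and summ: "\<And>y. y \<in> S \<Longrightarrow> (\<lambda>i. norm (f i y)) summable_on I"
    and deriv: "\<And>i y. i \<in> I \<Longrightarrow> y \<in> S \<Longrightarrow> (f i has_derivative f' i y) (at y)"
    and M: "M summable_on I"
    and bound: "\<And>i y h. i \<in> I \<Longrightarrow> y \<in> S \<Longrightarrow> norm (f' i y h) \<le> M i * norm h"
  shows "((\<lambda>y. \<Sum>\<^sub>\<infinity>i\<in>I. f i y) has_derivative (\<lambda>h. \<Sum>\<^sub>\<infinity>i\<in>I. f' i x h)) (at x)"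
proof -
  define b where "b = from_nat_into I"
  have b: "bij_betw b UNIV I"
    unfolding b_def using I by (rule bij_betw_from_nat_into)
  have bI: "b n \<in> I" for n
    using b by (auto simp: bij_betw_def)
  have sums: "(\<lambda>n. g (b n)) sums (\<Sum>\<^sub>\<infinity>i\<in>I. g i)"
    if "(\<lambda>i. norm (g i)) summable_on I" for g :: "'i \<Rightarrow> 'c::banach"
  proof -
    have "(g has_sum (\<Sum>\<^sub>\<infinity>i\<in>I. g i)) I"
      using that abs_summable_summable has_sum_infsum by blast
    then have "((\<lambda>n. g (b n)) has_sum (\<Sum>\<^sub>\<infinity>i\<in>I. g i)) UNIV"
      using has_sum_reindex_bij_betw[OF b] by blast
    then show ?thesis
      by (rule has_sum_imp_sums)
  qed
  have summ': "(\<lambda>i. norm (f' i y h)) summable_on I" if "y \<in> S" for y h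
    by (rule summable_on_comparison_test[OF summable_on_cmult_left[OF M, of "norm h"]])
      (use bound that in auto)
  have "summable (\<lambda>n. M (b n))"
    using M summable_on_reindex_bij_betw[OF b, of M] summable_on_imp_summable by blast
  then have tail: "\<exists>N. \<forall>n\<ge>N. norm ((\<Sum>i. M (b (i + n)))) < e" if "0 < e" for e
    using suminf_exist_split[OF that] by blast
  have "\<exists>g. \<forall>y\<in>S. (\<lambda>n. f (b n) y) sums g y
          \<and> (g has_derivative (\<lambda>h. \<Sum>\<^sub>\<infinity>i\<in>I. f' i y h)) (at y within S)"
  proof (rule has_derivative_series[OF S(2)])
    show "(f (b n) has_derivative f' (b n) y) (at y within S)" if "y \<in> S" for n y
      using deriv[OF bI that] by (rule has_derivative_at_withinI)
    show "x \<in> S" by (rule x)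
    show "(\<lambda>n. f (b n) x) sums (\<Sum>\<^sub>\<infinity>i\<in>I. f i x)"
      using sums[OF summ[OF x]] .
    fix e :: real assume "0 < e"
    from tail[OF this] obtain N where N: "\<And>n. n \<ge> N \<Longrightarrow> norm (\<Sum>i. M (b (i + n))) < e"
      by blast
    have "norm ((\<Sum>i<n. f' (b i) y h) - (\<Sum>\<^sub>\<infinity>i\<in>I. f' i y h)) \<le> e * norm h"
      if "n \<ge> N" "y \<in> S" for n y h
    proof -
      have s: "(\<lambda>n. f' (b n) y h) sums (\<Sum>\<^sub>\<infinity>i\<in>I. f' i y h)"
        using sums[OF summ'[OF that(2)]] .
      \<comment> \<open>The error of a partial sum is minus a tail, dominated by the tail of
        \<open>M\<close> times \<open>norm h\<close>. The index \<open>N\<close> depends on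
        \<open>e\<close> alone, which gives uniformity in \<open>y\<close> and
        \<open>h\<close>.\<close>
      have "(\<Sum>i<n. f' (b i) y h) - (\<Sum>\<^sub>\<infinity>i\<in>I. f' i y h) = - (\<Sum>i. f' (b (i + n)) y h)"
        using suminf_minus_initial_segment[OF sums_summable[OF s], of n] s by (simp add: sums_iff)
      moreover have "norm (\<Sum>i. f' (b (i + n)) y h) \<le> (\<Sum>i. M (b (i + n)) * norm h)"
        using \<open>summable (\<lambda>n. M (b n))\<close>
        by (intro norm_suminf_le summable_mult2) (simp_all add: bound bI that summable_iff_shift[of "\<lambda>n. M (b n)"])
      moreover have "(\<Sum>i. M (b (i + n)) * norm h) = (\<Sum>i. M (b (i + n))) * norm h"
        using \<open>summable (\<lambda>n. M (b n))\<close> 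
        by (intro suminf_mult2[symmetric]) (simp add: summable_iff_shift[of "\<lambda>n. M (b n)"])
      moreover have "(\<Sum>i. M (b (i + n))) * norm h \<le> e * norm h"
        using N[OF that(1)] by (intro mult_right_mono) auto
      ultimately show ?thesis by simp
    qed
    then show "\<forall>\<^sub>F n in sequentially. \<forall>y\<in>S. \<forall>h.
        norm ((\<Sum>i<n. f' (b i) y h) - (\<Sum>\<^sub>\<infinity>i\<in>I. f' i y h)) \<le> e * norm h"
      unfolding eventually_sequentially by blast
  qed
  then obtain g where g: "\<And>y. y \<in> S \<Longrightarrow> (\<lambda>n. f (b n) y) sums g y"
    and g': "(g has_derivative (\<lambda>h. \<Sum>\<^sub>\<infinity>i\<in>I. f' i x h)) (at x within S)"
    using x by blast
  have eq: "(\<Sum>\<^sub>\<infinity>i\<in>I. f i y) = g y" if "y \<in> S" for y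
    using sums_unique2[OF sums[OF summ[OF that]] g[OF that]] .
  have "((\<lambda>y. \<Sum>\<^sub>\<infinity>i\<in>I. f i y) has_derivative (\<lambda>h. \<Sum>\<^sub>\<infinity>i\<in>I. f' i x h)) (at x within S)"
    by (rule has_derivative_transform[OF x eq g'])
  then show ?thesis
    by (simp only: at_within_open[OF x S(1)])
qed

text \<open>A separated solution of the heat equation with diffusivity \<open>\<nu>\<close> on the
  circle. Phase and time are paired so that one Frechet derivative covers both, ready for the chain
  rule along a phase that moves in time.\<close>

definition heat_mode :: "real \<Rightarrow> int \<Rightarrow> real \<times> real \<Rightarrow> complex" where
  "heat_mode \<nu> m z = exp (complex_of_real (- ((real_of_int m)\<^sup>2 * \<nu> * snd z)) + \<i> * of_int m * complex_of_real (fst z))"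

definition heat_series :: "real \<Rightarrow> (int \<Rightarrow> complex^'n) \<Rightarrow> real \<times> real \<Rightarrow> complex^'n" where
  "heat_series \<nu> a z = (\<Sum>\<^sub>\<infinity>m\<in>Zstar. heat_mode \<nu> m z *s a m)"

text \<open>This class is stable under phase differentiation, which only multiplies coefficients by
  powers of \<open>m\<close>, and at positive time the Gaussian factor beats any such
  growth.\<close>

definition poly_growth :: "(int \<Rightarrow> complex^'n) \<Rightarrow> bool" where
  "poly_growth a \<longleftrightarrow> (\<exists>C N. \<forall>m\<in>Zstar. norm (a m) \<le> C * \<bar>real_of_int m\<bar> ^ N)"

lemma poly_growth_smult:
  assumes "poly_growth a" and "\<And>m. m \<in> Zstar \<Longrightarrow> norm (c m) \<le> D * \<bar>real_of_int m\<bar> ^ j"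
  shows "poly_growth (\<lambda>m. c m *s a m)"
proof -
  obtain C N where C: "\<And>m. m \<in> Zstar \<Longrightarrow> norm (a m) \<le> C * \<bar>real_of_int m\<bar> ^ N"
    using assms(1) by (auto simp: poly_growth_def)
  have "norm (c m *s a m) \<le> (D * C) * \<bar>real_of_int m\<bar> ^ (j + N)" if "m \<in> Zstar" for m
  proof -
    have "norm (c m) * norm (a m) \<le> (D * \<bar>real_of_int m\<bar> ^ j) * (C * \<bar>real_of_int m\<bar> ^ N)"
      using order_trans[OF norm_ge_zero assms(2)[OF that]]
      by (intro mult_mono assms(2) C that) auto
    then show ?thesis
      by (simp add: norm_vector_smult power_add algebra_simps)
  qed
  then show ?thesis
    unfolding poly_growth_def by blast
qed

text \<open>The two multipliers are the symbols of the first and second phase derivative.\<close>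

lemma poly_growth_deriv:
  assumes "poly_growth a"
  shows "poly_growth (\<lambda>m. (\<i> * of_int m) *s a m)" and "poly_growth (\<lambda>m. (- (of_int m)\<^sup>2) *s a m)"
  by (rule poly_growth_smult[OF assms, where D = 1 and j = 1], simp add: norm_mult)
    (rule poly_growth_smult[OF assms, where D = 1 and j = 2], simp add: norm_power)

text \<open>On the naturals the terms are eventually dominated by a multiple of 1/n^2. The nonzero
  integers are two disjoint copies of the positive ones, and the terms are even in
  \<open>m\<close>.\<close>

lemma summable_on_Zstar_gaussian:
  assumes "0 < c"
  shows "(\<lambda>m::int. \<bar>real_of_int m\<bar> ^ N * exp (- c * (real_of_int m)\<^sup>2)) summable_on Zstar"
proof -
  let ?f = "\<lambda>m::int. \<bar>real_of_int m\<bar> ^ N * exp (- c * (real_of_int m)\<^sup>2)"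
  have "(\<lambda>n. real n ^ N * exp (- c * (real n)\<^sup>2)) \<in> O(\<lambda>n. 1 / real n ^ 2)"
    using assms by real_asymp
  then have "summable (\<lambda>n. real n ^ N * exp (- c * (real n)\<^sup>2))"
    by (rule summable_comparison_test_bigo[rotated]) (simp add: inverse_power_summable divide_inverse)
  then have nat: "(\<lambda>n. real n ^ N * exp (- c * (real n)\<^sup>2)) summable_on A" for A
    by (intro summable_on_subset[OF norm_summable_imp_summable_on]) (auto simp: abs_mult)
  have "?f summable_on int ` {1..}"
    by (subst summable_on_reindex) (use nat[of "{1..}"] in \<open>simp_all add: o_def inj_on_def\<close>)
  moreover have "?f summable_on (\<lambda>n. - int n) ` {1..}"
    by (subst summable_on_reindex) (use nat[of "{1..}"] in \<open>simp_all add: o_def inj_on_def\<close>)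
  moreover have "int ` {1..} \<inter> (\<lambda>n. - int n) ` {1..} = {}"
    by auto
  ultimately have "?f summable_on int ` {1..} \<union> (\<lambda>n. - int n) ` {1..}"
    by (rule summable_on_Un_disjoint)
  moreover have "Zstar = int ` {1..} \<union> (\<lambda>n. - int n) ` {1..}"
  proof -
    have "m \<in> int ` {1..} \<union> (\<lambda>n. - int n) ` {1..}" if "m \<noteq> 0" for m
    proof (cases "m > 0")
      case True
      then have "m = int (nat m)" "nat m \<in> {1..}" by auto
      then show ?thesis by blast
    next
      case False
      then have "m = - int (nat (- m))" "nat (- m) \<in> {1..}" using that by auto
      then show ?thesis by blast
    qed
    then show ?thesis by auto
  qed
  ultimately show ?thesis by (simp only:)
qed

lemma norm_heat_mode: "norm (heat_mode \<nu> m (s, t)) = exp (- (\<nu> * t) * (real_of_int m)\<^sup>2)"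
  by (simp add: heat_mode_def algebra_simps)

lemma abs_summable_heat_series:
  assumes "0 < \<nu>" "0 < t" "poly_growth a"
  shows "(\<lambda>m. norm (heat_mode \<nu> m (s, t) *s a m)) summable_on Zstar"
proof -
  obtain C N where C: "\<And>m. m \<in> Zstar \<Longrightarrow> norm (a m) \<le> C * \<bar>real_of_int m\<bar> ^ N"
    using assms(3) by (auto simp: poly_growth_def)
  have "(\<lambda>m. C * (\<bar>real_of_int m\<bar> ^ N * exp (- (\<nu> * t) * (real_of_int m)\<^sup>2))) summable_on Zstar"
    using assms by (intro summable_on_cmult_right summable_on_Zstar_gaussian) simp
  then show ?thesis
    by (rule summable_on_comparison_test)
      (auto simp: norm_vector_smult norm_heat_mode mult.commute[of "exp _"] mult.assoc[symmetric]
         intro!: mult_right_mono C)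
qed

lemma has_derivative_heat_mode:
  "(heat_mode \<nu> m has_derivative
     (\<lambda>h. heat_mode \<nu> m z * (\<i> * of_int m * complex_of_real (fst h) - complex_of_real ((real_of_int m)\<^sup>2 * \<nu> * snd h)))) (at z)"
proof -
  let ?l = "\<lambda>h. complex_of_real (- ((real_of_int m)\<^sup>2 * \<nu> * snd h)) + \<i> * of_int m * complex_of_real (fst h)"
  have "bounded_linear ?l"
    by (intro bounded_linear_add bounded_linear_compose[OF bounded_linear_of_real] bounded_linear_minus
        bounded_linear_const_mult bounded_linear_fst bounded_linear_snd)
  then have "(?l has_derivative ?l) (at z)"
    by (rule bounded_linear_imp_has_derivative)
  from has_derivative_compose[OF this DERIV_exp[unfolded has_field_derivative_def]]
  show ?thesis
    by (simp add: heat_mode_def[abs_def])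
qed

lemma has_derivative_heat_series:
  assumes \<nu>: "0 < \<nu>" and t: "0 < t" and a: "poly_growth a"
  shows "(heat_series \<nu> a has_derivative
           (\<lambda>h. fst h *\<^sub>R heat_series \<nu> (\<lambda>m. (\<i> * of_int m) *s a m) (s, t)
              + (\<nu> * snd h) *\<^sub>R heat_series \<nu> (\<lambda>m. (- (of_int m)\<^sup>2) *s a m) (s, t))) (at (s, t))"
proof -
  obtain C N where C: "\<And>m. m \<in> Zstar \<Longrightarrow> norm (a m) \<le> C * \<bar>real_of_int m\<bar> ^ N"
    using a by (auto simp: poly_growth_def)
  have C0: "0 \<le> C"
    using order_trans[OF norm_ge_zero C[of 1]] by simp
  \<comment> \<open>Keeping time above \<open>t / 2\<close> leaves a uniform Gaussian factor, while
    the half-plane is still open, convex and contains the given point.\<close>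
  define S :: "(real \<times> real) set" where "S = UNIV \<times> {t / 2<..}"
  define f' where "f' = (\<lambda>m z h. (heat_mode \<nu> m z * (\<i> * of_int m * complex_of_real (fst h)
      - complex_of_real ((real_of_int m)\<^sup>2 * \<nu> * snd h))) *s a m)"
  \<comment> \<open>The derivative of a mode costs a factor (1 + \<nu>) m^2, the coefficient
    contributes C |m|^N, and the exponential is the mode's modulus at the smallest admissible time
    \<open>t / 2\<close>.\<close>
  define M where "M = (\<lambda>m. ((1 + \<nu>) * C) * (\<bar>real_of_int m\<bar> ^ (N + 2) * exp (- (\<nu> * (t / 2)) * (real_of_int m)\<^sup>2)))"
  note a1 = poly_growth_deriv(1)[OF a] and a2 = poly_growth_deriv(2)[OF a]
  have "((\<lambda>z. \<Sum>\<^sub>\<infinity>m\<in>Zstar. heat_mode \<nu> m z *s a m) has_derivative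
      (\<lambda>h. \<Sum>\<^sub>\<infinity>m\<in>Zstar. f' m (s, t) h)) (at (s, t))"
  proof (rule has_derivative_infsum[where S = S and M = M])
    show "countable Zstar" by simp
    show "infinite Zstar" by (simp add: infinite_UNIV_int)
    show "open S" "convex S"
      unfolding S_def by (auto intro: open_Times convex_Times)
    show "(s, t) \<in> S" using t by (simp add: S_def)
    show "(\<lambda>m. norm (heat_mode \<nu> m z *s a m)) summable_on Zstar" if "z \<in> S" for z
      using that t abs_summable_heat_series[OF \<nu> _ a, of "snd z" "fst z"] by (auto simp: S_def)
    show "((\<lambda>z. heat_mode \<nu> m z *s a m) has_derivative f' m z) (at z)" for m z
      unfolding f'_def
      by (rule bounded_linear.has_derivative[OF bounded_linear_vector_smult_left has_derivative_heat_mode])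
    show "M summable_on Zstar"
      unfolding M_def using \<nu> t by (intro summable_on_cmult_right summable_on_Zstar_gaussian) simp
    fix m :: int and z h :: "real \<times> real"
    assume m: "m \<in> Zstar" and z: "z \<in> S"
    let ?m = "\<bar>real_of_int m\<bar>"
    have m1: "1 \<le> ?m" using m by simp
    have "norm (\<i> * of_int m * complex_of_real (fst h) - complex_of_real ((real_of_int m)\<^sup>2 * \<nu> * snd h))
        \<le> ?m * \<bar>fst h\<bar> + ?m\<^sup>2 * \<nu> * \<bar>snd h\<bar>"
      using \<nu> by (intro order_trans[OF norm_triangle_ineq4]) (simp add: norm_mult norm_power abs_mult)
    \<comment> \<open>A nonzero integer satisfies |m| <= m^2, so the phase and time parts share one
      power.\<close>
    also have "\<dots> \<le> ?m\<^sup>2 * norm h + ?m\<^sup>2 * \<nu> * norm h"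
      using \<nu> self_le_power[OF m1, of 2] norm_fst_le[of "fst h" "snd h"] norm_snd_le[of "snd h" "fst h"]
      by (intro add_mono mult_mono) auto
    finally have 1: "norm (\<i> * of_int m * complex_of_real (fst h) - complex_of_real ((real_of_int m)\<^sup>2 * \<nu> * snd h))
        \<le> (1 + \<nu>) * ?m\<^sup>2 * norm h" by (simp add: algebra_simps)
    have 2: "norm (heat_mode \<nu> m z) \<le> exp (- (\<nu> * (t / 2)) * (real_of_int m)\<^sup>2)"
    proof -
      have "t / 2 * (\<nu> * (real_of_int m)\<^sup>2) \<le> snd z * (\<nu> * (real_of_int m)\<^sup>2)"
        using z \<nu> by (intro mult_right_mono) (auto simp: S_def)
      then show ?thesis
        using norm_heat_mode[of \<nu> m "fst z" "snd z"] by (simp add: algebra_simps)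
    qed
    have "norm (f' m z h) \<le> (exp (- (\<nu> * (t / 2)) * (real_of_int m)\<^sup>2) * ((1 + \<nu>) * ?m\<^sup>2 * norm h)) * (C * ?m ^ N)"
      unfolding f'_def norm_vector_smult norm_mult[of "heat_mode _ _ _"]
      using \<nu> by (intro mult_mono 1 2 C m) auto
    then show "norm (f' m z h) \<le> M m * norm h"
      unfolding M_def power_add by (simp only: mult_ac)
  qed
  moreover have "(\<Sum>\<^sub>\<infinity>m\<in>Zstar. f' m (s, t) h) =
      fst h *\<^sub>R heat_series \<nu> (\<lambda>m. (\<i> * of_int m) *s a m) (s, t)
        + (\<nu> * snd h) *\<^sub>R heat_series \<nu> (\<lambda>m. (- (of_int m)\<^sup>2) *s a m) (s, t)" for h
  proof -
    have "f' m (s, t) h = fst h *\<^sub>R (heat_mode \<nu> m (s, t) *s ((\<i> * of_int m) *s a m))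
        + (\<nu> * snd h) *\<^sub>R (heat_mode \<nu> m (s, t) *s ((- (of_int m)\<^sup>2) *s a m))" for m
      unfolding f'_def scaleR_vector_smult vector_smult_assoc vector_sadd_rdistrib[symmetric]
      by (rule arg_cong[where f = "\<lambda>c. c *s a m"]) (simp add: algebra_simps)
    moreover have "((\<lambda>m. heat_mode \<nu> m (s, t) *s ((\<i> * of_int m) *s a m)) has_sum
        heat_series \<nu> (\<lambda>m. (\<i> * of_int m) *s a m) (s, t)) Zstar"
      unfolding heat_series_def
      by (rule has_sum_infsum[OF abs_summable_summable[OF abs_summable_heat_series[OF \<nu> t a1]]])
    moreover have "((\<lambda>m. heat_mode \<nu> m (s, t) *s ((- (of_int m)\<^sup>2) *s a m)) has_sum
        heat_series \<nu> (\<lambda>m. (- (of_int m)\<^sup>2) *s a m) (s, t)) Zstar"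
      unfolding heat_series_def
      by (rule has_sum_infsum[OF abs_summable_summable[OF abs_summable_heat_series[OF \<nu> t a2]]])
    ultimately show ?thesis
      by (simp only:) (intro infsumI has_sum_add has_sum_scaleR)
  qed
  moreover have "heat_series \<nu> a = (\<lambda>z. \<Sum>\<^sub>\<infinity>m\<in>Zstar. heat_mode \<nu> m z *s a m)"
    by (rule ext) (rule heat_series_def)
  ultimately show ?thesis
    by simp
qed

section \<open>Transverse waves\<close>

lemma linear_cross: "linear (cross3 a)"
  by (rule linearI) (simp_all add: cross_add_right cross_mult_right)

lemma bounded_linear_cross: "bounded_linear (cross3 a)"
  using linear_cross by (simp add: linear_conv_bounded_linear)

lemma J_vector_mult: "J *v x = cross3 (axis 3 1) x"
  unfolding J_def by (simp add: matrix_works linear_cross)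

text \<open>For a unit vector \<open>a\<close> this is the rotation by the angle about
  \<open>a\<close> only on the plane orthogonal to \<open>a\<close>; the component along
  \<open>a\<close> is scaled by the cosine. Hence the orthogonality assumptions in the lemmas on
  \<open>rot\<close>.\<close>

definition rot :: "real^3 \<Rightarrow> real \<Rightarrow> real^3 \<Rightarrow> real^3" where
  "rot a \<theta> x = cos \<theta> *\<^sub>R x + sin \<theta> *\<^sub>R cross3 a x"

lemma bounded_linear_rot: "bounded_linear (rot a \<theta>)"
  unfolding rot_def[abs_def]
  by (intro bounded_linear_add bounded_linear_const_scaleR bounded_linear_ident bounded_linear_cross)

lemma inner_rot: "a \<bullet> rot a \<theta> x = cos \<theta> * (a \<bullet> x)"
  by (simp add: rot_def inner_add_right dot_cross_self)

lemma cross_cross_orthogonal: "norm a = 1 \<Longrightarrow> a \<bullet> x = 0 \<Longrightarrow> cross3 a (cross3 a x) = - x"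
  by (simp add: Lagrange norm_eq_1)

text \<open>On the plane orthogonal to \<open>a\<close>, crossing twice with \<open>a\<close> is
  minus the identity, so \<open>z\<close> can be replaced by a double cross product and the
  resulting triple product expanded.\<close>

lemma cross_orthogonal_decomposition:
  assumes "norm a = 1" "a \<bullet> z = 0"
  shows "cross3 e z = (e \<bullet> a) *\<^sub>R cross3 a z - (cross3 e a \<bullet> z) *\<^sub>R a"
proof -
  have "cross3 e z = - cross3 e (cross3 a (cross3 a z))"
    using cross_cross_orthogonal[OF assms] by simp
  also have "\<dots> = (e \<bullet> a) *\<^sub>R cross3 a z - (e \<bullet> cross3 a z) *\<^sub>R a"
    by (simp add: Lagrange[of e a "cross3 a z"])
  also have "e \<bullet> cross3 a z = cross3 e a \<bullet> z"
    by (metis cross_triple inner_commute)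
  finally show ?thesis .
qed

text \<open>Transfers the rotation from the wave to the fixed direction. The sine term arises from
  (e x a) . (a x x) = (e . a)(a . x) - (e . x)(a . a) = -(e . x).\<close>

lemma cross_inner_rot:
  assumes "norm a = 1" "a \<bullet> x = 0"
  shows "cross3 e a \<bullet> rot a (- \<theta>) x = (cos \<theta> *\<^sub>R cross3 e a + sin \<theta> *\<^sub>R e) \<bullet> x"
proof -
  have "cross3 e a \<bullet> cross3 a x = - (e \<bullet> x)"
    using assms by (simp add: dot_cross norm_eq_1)
  then show ?thesis
    by (simp add: rot_def inner_add_left inner_add_right inner_diff_right)
qed

text \<open>Besides the rotated derivative of \<open>g\<close>, the product rule yields a quarter
  turn of the rotated vector; orthogonality of \<open>g t\<close> to \<open>a\<close> is what
  identifies it with a cross product by \<open>a\<close>.\<close>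

lemma rot_has_vector_derivative:
  assumes "(g has_vector_derivative g') (at t)" and "norm a = 1" "a \<bullet> g t = 0"
  shows "((\<lambda>s. rot a (\<omega> * s) (g s)) has_vector_derivative
           \<omega> *\<^sub>R cross3 a (rot a (\<omega> * t) (g t)) + rot a (\<omega> * t) g') (at t)"
proof -
  have c: "((\<lambda>s. cos (\<omega> * s)) has_field_derivative - \<omega> * sin (\<omega> * t)) (at t)"
    "((\<lambda>s. sin (\<omega> * s)) has_field_derivative \<omega> * cos (\<omega> * t)) (at t)"
    by (auto intro!: derivative_eq_intros)
  have deriv: "((\<lambda>s. rot a (\<omega> * s) (g s)) has_vector_derivative
      (cos (\<omega> * t) *\<^sub>R g' + (- \<omega> * sin (\<omega> * t)) *\<^sub>R g t) +
      (sin (\<omega> * t) *\<^sub>R cross3 a g' + (\<omega> * cos (\<omega> * t)) *\<^sub>R cross3 a (g t))) (at t)"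
    unfolding rot_def
    by (intro has_vector_derivative_add has_vector_derivative_scaleR c assms(1)
        bounded_linear.has_vector_derivative[OF bounded_linear_cross])
  have cross: "cross3 a (rot a (\<omega> * t) (g t)) = cos (\<omega> * t) *\<^sub>R cross3 a (g t) - sin (\<omega> * t) *\<^sub>R g t"
    using cross_cross_orthogonal[OF assms(2,3)]
    by (simp add: rot_def cross_add_right cross_mult_right)
  show ?thesis
    unfolding cross using deriv by (simp add: rot_def algebra_simps)
qed

lemma continuous_on_rot:
  fixes S :: "'a::t2_space set"
  assumes "continuous_on S \<theta>" "continuous_on S g"
  shows "continuous_on S (\<lambda>z. rot a (\<theta> z) (g z))"
  unfolding rot_def
  by (intro continuous_on_add continuous_on_scaleR continuous_on_cos continuous_on_sin
      bounded_linear.continuous_on[OF bounded_linear_cross] assms)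

lemma partial_eqI: "(f has_derivative f') (at x) \<Longrightarrow> partial j f x = f' (axis j 1)"
  unfolding partial_def by (metis frechet_derivative_at)

text \<open>The arguments of \<open>W\<close> and \<open>Q\<close> are phase and time: \<open>W1, W2, W3\<close> are the successive phase
  derivatives of \<open>W\<close>, which solves the heat equation with diffusivity \<open>r\<^sup>2\<close>, and \<open>Q\<close> is
  \<open>- 1 / r\<close> times a phase primitive of \<open>W\<close>.\<close>

locale transverse_wave =
  fixes \<Omega> r :: real and a :: "real^3" and U V :: "real \<Rightarrow> real^3"
    and W W1 W2 W3 Q Q2 :: "real \<times> real \<Rightarrow> real^3" and q :: "real \<Rightarrow> real"
  assumes r: "r > 0" and a: "norm a = 1"
    and U: "\<And>t. (U has_vector_derivative - \<Omega> *\<^sub>R (J *v U t)) (at t)"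
    and V: "\<And>t. t > 0 \<Longrightarrow> (V has_vector_derivative U t) (at t)"
    and W: "\<And>s t. t > 0 \<Longrightarrow> (W has_derivative
              (\<lambda>h. fst h *\<^sub>R W1 (s, t) + (r\<^sup>2 * snd h) *\<^sub>R W2 (s, t))) (at (s, t))"
    and W1: "\<And>s t. t > 0 \<Longrightarrow> (W1 has_derivative
              (\<lambda>h. fst h *\<^sub>R W2 (s, t) + (r\<^sup>2 * snd h) *\<^sub>R W3 (s, t))) (at (s, t))"
    and W2: "continuous_on (UNIV \<times> {0<..}) W2"
    and Q: "\<And>s t. t > 0 \<Longrightarrow> (Q has_derivative
              (\<lambda>h. fst h *\<^sub>R (- (1 / r) *\<^sub>R W (s, t)) + (r\<^sup>2 * snd h) *\<^sub>R Q2 (s, t))) (at (s, t))"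
    and orth: "\<And>s t. t > 0 \<Longrightarrow> a \<bullet> W (s, t) = 0"
begin

definition "K = r *\<^sub>R a"
definition "\<omega> = - (a $ 3) * \<Omega>"
definition "at_phase G x t = G (K \<bullet> (x - V t), t)" for G :: "real \<times> real \<Rightarrow> real^3"
definition "velocity x t = U t + rot a (\<omega> * t) (at_phase W x t)"
text \<open>By \<open>cross_inner_rot\<close>, pairing this vector with a wave orthogonal to
  \<open>a\<close> equals pairing e3 x a with the wave rotated by \<open>\<omega> * t\<close>. So it
  extracts, up to sign, the component along \<open>a\<close> of the Coriolis force on the
  wave.\<close>

definition "pdir t = cos (a $ 3 * \<Omega> * t) *\<^sub>R (J *v a) + sin (a $ 3 * \<Omega> * t) *\<^sub>R axis 3 1"
definition "pressure x t = q t - \<Omega> * (pdir t \<bullet> at_phase Q x t)"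

section \<open>Fields along the moving phase\<close>

lemma has_derivative_at_phase:
  assumes "(G has_derivative (\<lambda>h. fst h *\<^sub>R G1 (K \<bullet> (x - V t), t) + (c * snd h) *\<^sub>R G2))
     (at (K \<bullet> (x - V t), t))"
  shows "((\<lambda>y. at_phase G y t) has_derivative (\<lambda>h. (K \<bullet> h) *\<^sub>R at_phase G1 x t)) (at x)"
proof -
  have "((\<lambda>y. (K \<bullet> (y - V t), t)) has_derivative (\<lambda>h. (K \<bullet> h, 0))) (at x)"
    by (auto intro!: derivative_eq_intros)
  from has_derivative_compose[OF this assms] show ?thesis
    by (simp add: at_phase_def)
qed

text \<open>For fixed \<open>x\<close> the phase K . (x - V(t)) decreases at the rate K . U(t); this
  produces the transport term that later cancels advection.\<close>

lemma at_phase_has_vector_derivative: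
  assumes "(G has_derivative (\<lambda>h. fst h *\<^sub>R G1 (K \<bullet> (x - V t), t) + (c * snd h) *\<^sub>R G2 (K \<bullet> (x - V t), t)))
     (at (K \<bullet> (x - V t), t))" and "t > 0"
  shows "(at_phase G x has_vector_derivative
     - (K \<bullet> U t) *\<^sub>R at_phase G1 x t + c *\<^sub>R at_phase G2 x t) (at t)"
proof -
  have "((\<lambda>t. (K \<bullet> (x - V t), t)) has_derivative (\<lambda>h. (K \<bullet> (- (h *\<^sub>R U t)), h))) (at t)"
    using V[OF assms(2)] unfolding has_vector_derivative_def
    by (auto intro!: derivative_eq_intros)
  from has_derivative_compose[OF this assms(1)] show ?thesis
    by (simp add: at_phase_def[abs_def] has_vector_derivative_def algebra_simps)
qed

lemma continuous_on_at_phase: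
  assumes "continuous_on (UNIV \<times> {0<..}) G"
  shows "continuous_on (UNIV \<times> {0<..}) (\<lambda>(x, t). at_phase G x t)"
proof -
  have "continuous_on {0<..} V"
    using V by (auto intro!: continuous_at_imp_continuous_on has_vector_derivative_continuous)
  then have "continuous_on (UNIV \<times> {0<..}) (\<lambda>z. V (snd z))"
    by (rule continuous_on_compose2) (auto intro: continuous_intros)
  then show ?thesis
    unfolding at_phase_def case_prod_beta
    by (intro continuous_on_compose2[OF assms] continuous_intros) auto
qed

lemma continuous_W: "continuous_on (UNIV \<times> {0<..}) W" "continuous_on (UNIV \<times> {0<..}) W1"
  using W W1 by (auto intro!: continuous_at_imp_continuous_on has_derivative_continuous)

lemma continuous_U: "continuous_on (UNIV \<times> {0<..}) (\<lambda>z :: (real^3) \<times> real. U (snd z))"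
proof -
  have "continuous_on UNIV U"
    using U by (auto intro!: continuous_at_imp_continuous_on has_vector_derivative_continuous)
  then show ?thesis
    by (rule continuous_on_compose2) (auto intro: continuous_intros)
qed

section \<open>Derivatives of velocity and pressure\<close>

lemma has_derivative_rot_at_phase:
  assumes "(G has_derivative (\<lambda>h. fst h *\<^sub>R G1 (K \<bullet> (x - V t), t) + (c * snd h) *\<^sub>R G2))
     (at (K \<bullet> (x - V t), t))"
  shows "((\<lambda>y. rot a (\<omega> * t) (at_phase G y t)) has_derivative
     (\<lambda>h. (K \<bullet> h) *\<^sub>R rot a (\<omega> * t) (at_phase G1 x t))) (at x)"
  using bounded_linear.has_derivative[OF bounded_linear_rot has_derivative_at_phase[where ?G1.0 = G1, OF assms]]
  by (simp add: linear_simps(5)[OF bounded_linear_rot])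

lemma has_derivative_velocity:
  "t > 0 \<Longrightarrow> ((\<lambda>y. velocity y t) has_derivative (\<lambda>h. (K \<bullet> h) *\<^sub>R rot a (\<omega> * t) (at_phase W1 x t))) (at x)"
  using has_derivative_add[OF has_derivative_const has_derivative_rot_at_phase[where ?G1.0 = W1, OF W]]
  by (simp add: velocity_def)

lemma partial_velocity:
  "t > 0 \<Longrightarrow> partial j (\<lambda>y. velocity y t) = (\<lambda>x. (K $ j) *\<^sub>R rot a (\<omega> * t) (at_phase W1 x t))"
  by (rule ext, subst partial_eqI[OF has_derivative_velocity]) (simp_all add: inner_axis)

lemma has_derivative_partial_velocity:
  "t > 0 \<Longrightarrow> (partial j (\<lambda>y. velocity y t) has_derivative
     (\<lambda>h. (K $ j * (K \<bullet> h)) *\<^sub>R rot a (\<omega> * t) (at_phase W2 x t))) (at x)"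
  using has_derivative_scaleR_right[OF has_derivative_rot_at_phase[where ?G1.0 = W2, OF W1], of t "K $ j" x]
  by (simp add: partial_velocity)

lemma partial_partial_velocity:
  "t > 0 \<Longrightarrow> partial i (partial j (\<lambda>y. velocity y t)) x =
     (K $ j * K $ i) *\<^sub>R rot a (\<omega> * t) (at_phase W2 x t)"
  by (subst partial_eqI[OF has_derivative_partial_velocity]) (simp_all add: inner_axis)

lemma velocity_has_vector_derivative:
  assumes "t > 0"
  shows "(velocity x has_vector_derivative
     - \<Omega> *\<^sub>R (J *v U t) + (\<omega> *\<^sub>R cross3 a (rot a (\<omega> * t) (at_phase W x t))
       + rot a (\<omega> * t) (- (K \<bullet> U t) *\<^sub>R at_phase W1 x t + r\<^sup>2 *\<^sub>R at_phase W2 x t))) (at t)"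
  unfolding velocity_def[abs_def]
  using assms
  by (intro has_vector_derivative_add U rot_has_vector_derivative at_phase_has_vector_derivative W a)
    (simp_all add: at_phase_def orth)

lemma has_derivative_pressure:
  assumes "t > 0"
  shows "((\<lambda>y. pressure y t) has_derivative
     (\<lambda>h. (\<Omega> * (pdir t \<bullet> at_phase W x t) / r) * (K \<bullet> h))) (at x)"
proof -
  have "((\<lambda>y. at_phase Q y t) has_derivative
      (\<lambda>h. (K \<bullet> h) *\<^sub>R at_phase (\<lambda>z. - (1 / r) *\<^sub>R W z) x t)) (at x)"
    by (rule has_derivative_at_phase) (rule Q[OF assms])
  then have "((\<lambda>y. pressure y t) has_derivative
      (\<lambda>h. 0 - \<Omega> * (pdir t \<bullet> ((K \<bullet> h) *\<^sub>R at_phase (\<lambda>z. - (1 / r) *\<^sub>R W z) x t)))) (at x)"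
    unfolding pressure_def
    by (intro has_derivative_diff has_derivative_const has_derivative_mult_right has_derivative_inner_right)
  then show ?thesis
    by (simp add: at_phase_def mult_ac)
qed

text \<open>The chain rule yields a multiple of \<open>K\<close>, and the length \<open>r\<close> of
  \<open>K\<close> cancels the factor 1/r from the phase primitive.\<close>

lemma gradient_pressure:
  "t > 0 \<Longrightarrow> gradient (\<lambda>y. pressure y t) x = (\<Omega> * (pdir t \<bullet> at_phase W x t)) *\<^sub>R a"
  using r
  by (simp add: gradient_def vec_eq_iff partial_eqI[OF has_derivative_pressure] inner_axis)
    (simp add: K_def)

text \<open>The wave is transverse, so advection along the phase gradient sees only the mean flow;
  this removes the quadratic interaction of the wave with itself.\<close>

lemma inner_velocity: "t > 0 \<Longrightarrow> velocity x t \<bullet> K = U t \<bullet> K"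
  using inner_rot[of a "\<omega> * t" "at_phase W x t"] orth[of t "K \<bullet> (x - V t)"]
  by (simp add: velocity_def inner_commute[of _ K] inner_add_right) (simp add: at_phase_def K_def)

text \<open>Obtained by differentiating the identity \<open>a \<bullet> W (s, t) = 0\<close> in the
  phase; it supplies the vanishing divergence.\<close>

lemma orth_W1:
  assumes "t > 0" 
  shows "a \<bullet> W1 (s, t) = 0"
proof -
  have "((\<lambda>s. a \<bullet> W (s, t)) has_derivative (\<lambda>h. h * (a \<bullet> W1 (s, t)))) (at s)"
  proof -
    have "((\<lambda>s. (s, t)) has_derivative (\<lambda>h. (h, 0))) (at s)"
      by (auto intro!: derivative_eq_intros)
    from has_derivative_inner_right[OF has_derivative_compose[OF this W[OF assms]], of a]
    show ?thesis by simp
  qed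
  moreover have "((\<lambda>s. a \<bullet> W (s, t)) has_derivative (\<lambda>h. 0)) (at s)"
    using orth[OF assms] by simp
  ultimately show ?thesis
    by (metis has_derivative_unique mult_1)
qed

section \<open>Verification of the equations\<close>

lemma momentum:
  assumes t: "t > 0"
  shows "vector_derivative (\<lambda>s. velocity x s) (at t) - laplacian (\<lambda>y. velocity y t) x
        + advection (\<lambda>y. velocity y t) (\<lambda>y. velocity y t) x
        + gradient (\<lambda>y. pressure y t) x + \<Omega> *\<^sub>R (J *v velocity x t) = 0"
proof -
  let ?R = "rot a (\<omega> * t)"
  let ?z = "?R (at_phase W x t)"
  have dt: "vector_derivative (\<lambda>s. velocity x s) (at t) = - \<Omega> *\<^sub>R (J *v U t)
      + (\<omega> *\<^sub>R cross3 a ?z + (- (K \<bullet> U t) *\<^sub>R ?R (at_phase W1 x t) + r\<^sup>2 *\<^sub>R ?R (at_phase W2 x t)))"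
    using vector_derivative_at[OF velocity_has_vector_derivative[OF t]]
    by (simp add: linear_simps[OF bounded_linear_rot])
  have lap: "laplacian (\<lambda>y. velocity y t) x = r\<^sup>2 *\<^sub>R ?R (at_phase W2 x t)"
  proof -
    have "(\<Sum>j\<in>UNIV. K $ j * K $ j) = r\<^sup>2"
      using a by (simp add: K_def norm_eq_1 inner_vec_def power2_eq_square sum_distrib_left[symmetric] mult_ac)
    then show ?thesis
      by (simp add: laplacian_def partial_partial_velocity[OF t] scaleR_sum_left[symmetric])
  qed
  have adv: "advection (\<lambda>y. velocity y t) (\<lambda>y. velocity y t) x = (K \<bullet> U t) *\<^sub>R ?R (at_phase W1 x t)"
  proof -
    have "(\<Sum>j\<in>UNIV. velocity x t $ j * K $ j) = K \<bullet> U t"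
      using inner_velocity[OF t, of x] by (simp add: inner_vec_def mult.commute)
    then show ?thesis
      by (simp add: advection_def partial_velocity[OF t] scaleR_sum_left[symmetric])
  qed
  have Ju: "J *v velocity x t = J *v U t + a $ 3 *\<^sub>R cross3 a ?z - (pdir t \<bullet> at_phase W x t) *\<^sub>R a"
  proof -
    have o: "a \<bullet> at_phase W x t = 0"
      using orth[OF t] by (simp add: at_phase_def)
    then have "cross3 (axis 3 1) ?z = a $ 3 *\<^sub>R cross3 a ?z - (cross3 (axis 3 1) a \<bullet> ?z) *\<^sub>R a"
      using cross_orthogonal_decomposition[OF a, of ?z "axis 3 1"] by (simp add: inner_rot inner_axis')
    \<comment> \<open>The angle \<open>\<omega> * t\<close> is minus
      \<open>a $ 3 * \<Omega> * t\<close>, so carrying the rotation over to e3 x a gives exactly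
      \<open>pdir t\<close>.\<close>
    moreover have "cross3 (axis 3 1) a \<bullet> ?z = pdir t \<bullet> at_phase W x t"
      using cross_inner_rot[OF a o, of "axis 3 1" "a $ 3 * \<Omega> * t"]
      by (simp add: \<omega>_def pdir_def J_vector_mult)
    ultimately show ?thesis
      by (simp add: velocity_def matrix_vector_right_distrib J_vector_mult)
  qed
  \<comment> \<open>Everything cancels in pairs: the mean Coriolis term with U', diffusion with the
    Laplacian, transport with advection, the in-plane Coriolis term with the derivative of the
    rotation, and its component along \<open>a\<close> with the pressure gradient.\<close>
  show ?thesis
    unfolding dt lap adv Ju gradient_pressure[OF t, of x]
    by (simp add: \<omega>_def algebra_simps)
qed

lemma incompressible: "t > 0 \<Longrightarrow> divergence (\<lambda>y. velocity y t) x = 0"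
proof -
  assume t: "t > 0"
  have "divergence (\<lambda>y. velocity y t) x = K \<bullet> rot a (\<omega> * t) (at_phase W1 x t)"
    by (simp add: divergence_def partial_velocity[OF t] inner_vec_def)
  then show ?thesis
    using orth_W1[OF t] by (simp add: K_def inner_rot at_phase_def)
qed

text \<open>All derivatives have explicit formulas at positive times, so joint continuity reduces to
  that of \<open>W\<close>, \<open>W1\<close>, \<open>W2\<close> composed with the continuous moving
  phase.\<close>

lemma regularity: "classical_regularity velocity pressure"
proof -
  let ?D = "UNIV \<times> {0<..} :: ((real^3) \<times> real) set"
  have \<omega>: "continuous_on ?D (\<lambda>z. \<omega> * snd z)"
    by (intro continuous_intros)
  have ph: "continuous_on ?D (\<lambda>z. at_phase W (fst z) (snd z))"
    "continuous_on ?D (\<lambda>z. at_phase W1 (fst z) (snd z))"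
    "continuous_on ?D (\<lambda>z. at_phase W2 (fst z) (snd z))"
    using continuous_on_at_phase[OF continuous_W(1)] continuous_on_at_phase[OF continuous_W(2)]
      continuous_on_at_phase[OF W2] by (simp_all add: case_prod_beta)
  have "continuous_on ?D (\<lambda>(x, t). velocity x t)"
    unfolding velocity_def case_prod_beta
    by (intro continuous_on_add continuous_U continuous_on_rot \<omega> ph)
  moreover have "continuous_on ?D (\<lambda>(x, t). vector_derivative (\<lambda>s. velocity x s) (at t))"
  proof -
    have "continuous_on ?D (\<lambda>z. - \<Omega> *\<^sub>R (J *v U (snd z))
        + (\<omega> *\<^sub>R cross3 a (rot a (\<omega> * snd z) (at_phase W (fst z) (snd z)))
       + rot a (\<omega> * snd z) (- (K \<bullet> U (snd z)) *\<^sub>R at_phase W1 (fst z) (snd z) + r\<^sup>2 *\<^sub>R at_phase W2 (fst z) (snd z))))"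
      unfolding J_vector_mult
      by (intro continuous_intros continuous_U continuous_on_rot continuous_on_cross \<omega> ph)
    then show ?thesis
      by (rule continuous_on_eq) (auto simp: vector_derivative_at[OF velocity_has_vector_derivative])
  qed
  moreover have "continuous_on ?D (\<lambda>(x, t). partial j (\<lambda>y. velocity y t) x)" for j
  proof -
    have "continuous_on ?D (\<lambda>z. (K $ j) *\<^sub>R rot a (\<omega> * snd z) (at_phase W1 (fst z) (snd z)))"
      by (intro continuous_intros continuous_on_rot \<omega> ph)
    then show ?thesis
      by (rule continuous_on_eq) (auto simp: partial_velocity)
  qed
  moreover have "continuous_on ?D (\<lambda>(x, t). partial i (partial j (\<lambda>y. velocity y t)) x)" for i j
  proof -
    have "continuous_on ?D (\<lambda>z. (K $ j * K $ i) *\<^sub>R rot a (\<omega> * snd z) (at_phase W2 (fst z) (snd z)))"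
      by (intro continuous_intros continuous_on_rot \<omega> ph)
    then show ?thesis
      by (rule continuous_on_eq) (auto simp: partial_partial_velocity)
  qed
  moreover have "continuous_on ?D (\<lambda>(x, t). gradient (\<lambda>y. pressure y t) x)"
  proof -
    have "continuous_on ?D (\<lambda>z. (\<Omega> * (pdir (snd z) \<bullet> at_phase W (fst z) (snd z))) *\<^sub>R a)"
      unfolding pdir_def by (intro continuous_intros ph)
    then show ?thesis
      by (rule continuous_on_eq) (auto simp: gradient_pressure)
  qed
  moreover have "velocity x differentiable at t" if "t > 0" for x t
    using velocity_has_vector_derivative[OF that] by (rule differentiableI_vector)
  moreover have "(\<lambda>y. velocity y t) differentiable at x" if "t > 0" for x t
    using has_derivative_velocity[OF that] by (rule differentiableI)
  moreover have "partial j (\<lambda>y. velocity y t) differentiable at x" if "t > 0" for x t j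
    using has_derivative_partial_velocity[OF that] by (rule differentiableI)
  moreover have "(\<lambda>y. pressure y t) differentiable at x" if "t > 0" for x t
    using has_derivative_pressure[OF that] by (rule differentiableI)
  ultimately show ?thesis
    unfolding classical_regularity_def by blast
qed

lemma classical_solution: "classical_solution \<Omega> velocity pressure"
  unfolding classical_solution_def using regularity momentum incompressible by blast

end

section \<open>Complex Fourier modes and real fields\<close>

lemma bounded_linear_cvec_Re: "bounded_linear cvec_Re"
  unfolding linear_conv_bounded_linear[symmetric]
  by (rule linearI) (simp_all add: cvec_Re_def vec_eq_iff)

lemma bounded_linear_cvec_cnj: "bounded_linear cvec_cnj"
  unfolding linear_conv_bounded_linear[symmetric]
  by (rule linearI) (simp_all add: cvec_cnj_def vec_eq_iff complex_eq_iff)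

lemma bounded_linear_cdot_right: "bounded_linear ((\<bullet>\<^sub>c) x)"
  unfolding linear_conv_bounded_linear[symmetric]
  by (rule linearI) (simp_all add: cdot_def sum.distrib distrib_left scaleR_sum_right)

lemma cvec_cnj_smult: "cvec_cnj (c *s v) = cnj c *s cvec_cnj v"
  by (simp add: cvec_cnj_def vec_eq_iff)

lemma cdot_commute: "x \<bullet>\<^sub>c y = y \<bullet>\<^sub>c x"
  by (simp add: cdot_def mult.commute)

lemma cdot_smult_right: "x \<bullet>\<^sub>c (c *s y) = c * (x \<bullet>\<^sub>c y)"
  by (simp add: cdot_def sum_distrib_left mult_ac)

lemma cvec_scaleR: "cvec (c *\<^sub>R x) = complex_of_real c *s cvec x"
  by (simp add: cvec_def vec_eq_iff)

lemma cvec_add: "cvec (x + y) = cvec x + cvec y"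
  by (simp add: cvec_def vec_eq_iff)

lemma cvec_Re_cvec [simp]: "cvec_Re (cvec x) = x"
  by (simp add: cvec_Re_def cvec_def vec_eq_iff)

lemma cvec_cvec_Re: "cvec_cnj v = v \<Longrightarrow> cvec (cvec_Re v) = v"
  by (simp add: cvec_cnj_def cvec_def cvec_Re_def vec_eq_iff complex_eq_iff) 

lemma cdot_cvec: "cvec x \<bullet>\<^sub>c cvec y = complex_of_real (x \<bullet> y)"
  by (simp add: cdot_def cvec_def inner_vec_def)

lemma inner_cvec_Re: "x \<bullet> cvec_Re v = Re (cvec x \<bullet>\<^sub>c v)"
  by (simp add: cdot_def cvec_def cvec_Re_def inner_vec_def)

lemma map_matrix_vector_mult_cvec: "map_matrix complex_of_real A *v cvec x = cvec (A *v x)"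
  by (simp add: matrix_vector_mult_def cvec_def vec_eq_iff)

lemma Ek_vector_mult: "Ek L k \<theta> *v x = rot (ktilde L k) \<theta> x"
  by (simp add: Ek_def Jk_def rot_def matrix_vector_mult_add_rdistrib scaleR_matrix_vector_assoc[symmetric]
      matrix_works linear_cross)

section \<open>Real heat series\<close>

lemma heat_series_has_sum:
  "0 < \<nu> \<Longrightarrow> 0 < t \<Longrightarrow> poly_growth a \<Longrightarrow>
    ((\<lambda>m. heat_mode \<nu> m (s, t) *s a m) has_sum heat_series \<nu> a (s, t)) Zstar"
  unfolding heat_series_def by (rule has_sum_infsum[OF abs_summable_summable[OF abs_summable_heat_series]])

lemma heat_series_cong: "(\<And>m. m \<in> Zstar \<Longrightarrow> a m = b m) \<Longrightarrow> heat_series \<nu> a = heat_series \<nu> b"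
  unfolding heat_series_def by (intro ext infsum_cong) simp

lemma heat_series_scaleR: "heat_series \<nu> (\<lambda>m. c *\<^sub>R a m) z = c *\<^sub>R heat_series \<nu> a z"
proof -
  have "heat_mode \<nu> m z *s (c *\<^sub>R a m) = c *\<^sub>R (heat_mode \<nu> m z *s a m)" for m
    by (simp add: vec_eq_iff)
  then show ?thesis
    by (simp add: heat_series_def infsum_scaleR_right)
qed

lemma cnj_heat_mode: "cnj (heat_mode \<nu> m z) = heat_mode \<nu> (- m) z"
  unfolding heat_mode_def exp_cnj by (rule arg_cong[where f = exp]) (simp add: complex_eq_iff)

text \<open>Conjugation exchanges the terms of index \<open>m\<close> and \<open>- m\<close>, and
  reindexing by negation leaves the sum unchanged. Taking real parts therefore loses
  nothing.\<close>

lemma cvec_cnj_heat_series: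
  assumes "0 < \<nu>" "0 < t" "poly_growth a" and real: "\<And>m. m \<in> Zstar \<Longrightarrow> a (- m) = cvec_cnj (a m)"
  shows "cvec_cnj (heat_series \<nu> a (s, t)) = heat_series \<nu> a (s, t)"
proof -
  let ?f = "\<lambda>m. heat_mode \<nu> m (s, t) *s a m"
  have *: "cvec_cnj (?f m) = ?f (- m)" if "m \<in> Zstar" for m
    using real[OF that] by (simp add: cvec_cnj_smult cnj_heat_mode)
  have "((\<lambda>m. cvec_cnj (?f m)) has_sum cvec_cnj (heat_series \<nu> a (s, t))) Zstar"
    by (rule has_sum_bounded_linear[OF bounded_linear_cvec_cnj heat_series_has_sum[OF assms(1-3)]])
  then have "((\<lambda>m. ?f (- m)) has_sum cvec_cnj (heat_series \<nu> a (s, t))) Zstar"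
    by (subst (asm) has_sum_cong[OF *])
  moreover have "bij_betw uminus Zstar Zstar"
    by (rule bij_betwI[where g = uminus]) auto
  ultimately have "(?f has_sum cvec_cnj (heat_series \<nu> a (s, t))) Zstar"
    using has_sum_reindex_bij_betw[of uminus Zstar Zstar ?f] by blast
  then show ?thesis
    using heat_series_has_sum[OF assms(1-3)] has_sum_unique by blast
qed

lemma has_derivative_cvec_Re_heat_series:
  assumes "0 < \<nu>" "0 < t" "poly_growth a"
  shows "((\<lambda>z. cvec_Re (heat_series \<nu> a z)) has_derivative
      (\<lambda>h. fst h *\<^sub>R cvec_Re (heat_series \<nu> (\<lambda>m. (\<i> * of_int m) *s a m) (s, t))
         + (\<nu> * snd h) *\<^sub>R cvec_Re (heat_series \<nu> (\<lambda>m. (- (of_int m)\<^sup>2) *s a m) (s, t)))) (at (s, t))"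
  using bounded_linear.has_derivative[OF bounded_linear_cvec_Re has_derivative_heat_series[OF assms]]
  by (simp add: linear_simps[OF bounded_linear_cvec_Re])

text \<open>A single nonnegative term is at most the whole sum, and m^2 >= 1, so the coefficients
  are even bounded, by the square root of the sum.\<close>

lemma poly_growth_of_summable_weighted:
  assumes "(\<lambda>m. (real_of_int m)\<^sup>2 * (norm (a m))\<^sup>2) summable_on Zstar"
  shows "poly_growth a"
proof -
  define S where "S = (\<Sum>\<^sub>\<infinity>m\<in>Zstar. (real_of_int m)\<^sup>2 * (norm (a m))\<^sup>2)"
  have "norm (a m) \<le> sqrt S" if "m \<in> Zstar" for m
  proof (rule real_le_rsqrt)
    have "1 \<le> \<bar>real_of_int m\<bar>"
      using that by simp
    then have "(norm (a m))\<^sup>2 \<le> (real_of_int m)\<^sup>2 * (norm (a m))\<^sup>2"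
      using mult_right_mono[OF one_le_power[of _ 2], of _ "(norm (a m))\<^sup>2"] by fastforce
    also have "\<dots> \<le> S"
      unfolding S_def using finite_sum_le_infsum[OF assms, of "{m}"] that by simp
    finally show "(norm (a m))\<^sup>2 \<le> S" .
  qed
  then show ?thesis
    unfolding poly_growth_def by (intro exI[of _ "sqrt S"] exI[of _ 0]) simp
qed

text \<open>Positivity of \<open>t\<close> matters because \<open>{0..t}\<close> is empty for
  negative \<open>t\<close>, where the integral is 0. The right end \<open>t + 1\<close> makes
  \<open>t\<close> an interior point, so the one-sided statement becomes two-sided.\<close>

lemma integral_from_0_has_vector_derivative:
  fixes U :: "real \<Rightarrow> 'a::banach"
  assumes "continuous_on UNIV U" "0 < t"
  shows "((\<lambda>t. integral {0..t} U) has_vector_derivative U t) (at t)"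
proof -
  have "((\<lambda>t. integral {0..t} U) has_vector_derivative U t) (at t within {0..t + 1})"
    using assms by (intro integral_has_vector_derivative continuous_on_subset[OF assms(1)]) auto
  then show ?thesis
    using assms(2) by (simp add: at_within_interior[of t "{0..t + 1}"])
qed

lemma continuous_on_positive_time_cong:
  assumes "continuous_on (UNIV \<times> {0<..}) (\<lambda>(x, t). F x t)" "\<And>x t. t > 0 \<Longrightarrow> F x t = F' x t"
  shows "continuous_on (UNIV \<times> {0<..}) (\<lambda>(x, t :: real). F' x t)"
  using assms(1) by (rule continuous_on_eq) (auto simp: assms(2))

text \<open>Only positive times matter; at \<open>t \<le> 0\<close> the mode series may diverge and \<open>infsum\<close> is a junk value.\<close>

lemma classical_solution_cong:
  assumes sol: "classical_solution \<Omega> u p"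
    and u: "\<And>x t. t > 0 \<Longrightarrow> u x t = u' x t" and p: "\<And>x t. t > 0 \<Longrightarrow> p x t = p' x t"
  shows "classical_solution \<Omega> u' p'"
proof -
  \<comment> \<open>Space derivatives are taken at a fixed positive time, where the functions
    coincide everywhere. Time derivatives need only agreement near \<open>t\<close>, and the
    positive times form an open set.\<close>
  have us: "(\<lambda>y. u' y t) = (\<lambda>y. u y t)" and ps: "(\<lambda>y. p' y t) = (\<lambda>y. p y t)" if "t > 0" for t
    using u p that by auto
  have ev: "eventually (\<lambda>s. s \<in> UNIV \<longrightarrow> u' x s = u x s) (nhds t)" if "t > 0" for x t
    using eventually_nhds_in_open[of "{0<..}" t] that u by (auto elim: eventually_mono)
  have vd: "vector_derivative (u' x) (at t) = vector_derivative (u x) (at t)" if "t > 0" for x t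
    by (rule vector_derivative_cong_eq) (use ev[OF that] in auto)
  have diff: "u' x differentiable at t" if "t > 0" "u x differentiable at t" for x t
  proof -
    from that(2) obtain D where "(u x has_derivative D) (at t)"
      by (auto simp: differentiable_def)
    then have "(u' x has_derivative D) (at t)"
      by (rule has_derivative_transform_within_open[where s = "{0<..}"]) (use that(1) u in auto)
    then show ?thesis
      by (rule differentiableI)
  qed
  have reg: "classical_regularity u p"
    using sol by (simp add: classical_solution_def)
  have "classical_regularity u' p'"
    unfolding classical_regularity_def
  proof (intro conjI allI impI)
    fix x :: "real^3" and t :: real and i j :: 3
    note r = reg[unfolded classical_regularity_def]
    {
      assume t: "t > 0"
      show "(\<lambda>s. u' x s) differentiable at t"
        using r t by (intro diff) auto
      show "(\<lambda>y. u' y t) differentiable at x" "partial j (\<lambda>y. u' y t) differentiable at x"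
        "(\<lambda>y. p' y t) differentiable at x"
        using r t by (simp_all add: us ps)
    }
    show "continuous_on (UNIV \<times> {0<..}) (\<lambda>(x, t). u' x t)"
      by (rule continuous_on_positive_time_cong[where F = u]) (use r u in auto)
    show "continuous_on (UNIV \<times> {0<..}) (\<lambda>(x, t). vector_derivative (\<lambda>s. u' x s) (at t))"
      by (rule continuous_on_positive_time_cong[where F = "\<lambda>x t. vector_derivative (u x) (at t)"]) (use r in \<open>simp_all add: vd\<close>)
    show "continuous_on (UNIV \<times> {0<..}) (\<lambda>(x, t). partial j (\<lambda>y. u' y t) x)"
      by (rule continuous_on_positive_time_cong[where F = "\<lambda>x t. partial j (\<lambda>y. u y t) x"]) (use r in \<open>simp_all add: us\<close>)
    show "continuous_on (UNIV \<times> {0<..}) (\<lambda>(x, t). partial i (partial j (\<lambda>y. u' y t)) x)"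
      by (rule continuous_on_positive_time_cong[where F = "\<lambda>x t. partial i (partial j (\<lambda>y. u y t)) x"]) (use r in \<open>simp_all add: us\<close>)
    show "continuous_on (UNIV \<times> {0<..}) (\<lambda>(x, t). gradient (\<lambda>y. p' y t) x)"
      by (rule continuous_on_positive_time_cong[where F = "\<lambda>x t. gradient (\<lambda>y. p y t) x"]) (use r in \<open>simp_all add: ps\<close>)
  qed
  then show ?thesis
    using sol by (simp add: classical_solution_def vd u[symmetric] p[symmetric])
qed

lemma kcheck_nonzero:
  assumes "\<And>i. L $ i > 0" "k \<noteq> 0"
  shows "kcheck L k \<noteq> 0"
proof -
  obtain i where "k $ i \<noteq> 0"
    using assms(2) by (auto simp: vec_eq_iff)
  then have "kcheck L k $ i \<noteq> 0"
    using assms(1)[of i] by (simp add: kcheck_def)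
  then show ?thesis by auto
qed

text \<open>Summability and reality are asserted explicitly: \<open>infsum\<close> returns a default
  value on a family that is not summable, and \<open>cvec_Re\<close> and \<open>Re\<close> would
  silently discard an imaginary part.\<close>

theorem theorem5p4:
  fixes L :: "real^3" and \<Omega> :: real and k :: "int^3"
    and u0 w0 :: "real^3 \<Rightarrow> real^3" and U0 :: "real^3"
    and uhat0 :: "int \<Rightarrow> complex^3"
    and U V :: "real \<Rightarrow> real^3"
    and pstar :: "real \<Rightarrow> real"
    and u :: "real^3 \<Rightarrow> real \<Rightarrow> complex^3" and p :: "real^3 \<Rightarrow> real \<Rightarrow> complex"
    and u_mode :: "int \<Rightarrow> real^3 \<Rightarrow> real \<Rightarrow> complex^3"
    and p_mode :: "int \<Rightarrow> real^3 \<Rightarrow> real \<Rightarrow> complex"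
  assumes L_pos: "\<And>i. L $ i > 0"
    and L_max: "Max {L $ 1, L $ 2, L $ 3} = 2 * pi"
    and k_nz: "k \<noteq> 0"
    and u0: "u0 = (\<lambda>x. U0 + w0 x)"
    and w0: "w0 \<in> Vk L k" "Vk_expansion L k uhat0 w0"
    and U: "U = (\<lambda>t. mat_exp ((- (\<Omega> * t)) *\<^sub>R J) *v U0)"
    and V: "V = (\<lambda>t. integral {0..t} U)"
    and u_mode: "u_mode = (\<lambda>m x t.
          (exp (- complex_of_real ((real_of_int m)\<^sup>2 * (norm (kcheck L k))\<^sup>2 * t))
           * exp (- \<i> * of_int m * complex_of_real (kcheck L k \<bullet> V t))
           * wave L k m x)
          *s (map_matrix complex_of_real (Ek L k (- (ktilde L k $ 3) * \<Omega> * t)) *v uhat0 m))"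
    and p_mode: "p_mode = (\<lambda>m x t.
          \<i> / (of_int m * complex_of_real (norm (kcheck L k)))
          * exp (- complex_of_real ((real_of_int m)\<^sup>2 * (norm (kcheck L k))\<^sup>2 * t))
          * exp (- \<i> * of_int m * complex_of_real (kcheck L k \<bullet> V t))
          * (cvec (cos (ktilde L k $ 3 * \<Omega> * t) *\<^sub>R (J *v ktilde L k)
                   + sin (ktilde L k $ 3 * \<Omega> * t) *\<^sub>R axis 3 1) \<bullet>\<^sub>c uhat0 m)
          * wave L k m x)"
    and u: "u = (\<lambda>x t. cvec (U t) + (\<Sum>\<^sub>\<infinity>m\<in>Zstar. u_mode m x t))"
    and p: "p = (\<lambda>x t. complex_of_real (pstar t)
                        - complex_of_real \<Omega> * (\<Sum>\<^sub>\<infinity>m\<in>Zstar. p_mode m x t))"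
  shows "(\<forall>x. \<forall>t>0. (\<lambda>m. u_mode m x t) summable_on Zstar \<and>
                     (\<lambda>m. p_mode m x t) summable_on Zstar \<and>
                     u x t = cvec (cvec_Re (u x t)) \<and> p x t = complex_of_real (Re (p x t)))
         \<and> classical_solution \<Omega> (\<lambda>x t. cvec_Re (u x t)) (\<lambda>x t. Re (p x t))"
proof -
  define r where "r = norm (kcheck L k)"
  define a where "a = ktilde L k"
  define H where "H = (heat_series (r\<^sup>2) :: (int \<Rightarrow> complex^3) \<Rightarrow> real \<times> real \<Rightarrow> complex^3)"
  \<comment> \<open>Pressure coefficients: multiplying by i m returns -1/r times the velocity
    coefficients, so their series is the required phase primitive. The next two families are the
    first and second phase derivatives of the velocity coefficients.\<close>
  define b where "b = (\<lambda>m. (\<i> / (of_int m * complex_of_real r)) *s uhat0 m)"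
  define d where "d = (\<lambda>m. (\<i> * of_int m) *s uhat0 m)"
  define e where "e = (\<lambda>m. (- (of_int m)\<^sup>2) *s uhat0 m)"
  have r: "0 < r" "0 < r\<^sup>2"
    using kcheck_nonzero[OF L_pos k_nz] by (simp_all add: r_def)
  have a: "norm a = 1" and kcheck: "kcheck L k = r *\<^sub>R a"
    using r by (simp_all add: a_def ktilde_def r_def)
  have real: "\<And>m. m \<in> Zstar \<Longrightarrow> uhat0 (- m) = cvec_cnj (uhat0 m)"
    and orth: "\<And>m. m \<in> Zstar \<Longrightarrow> cvec a \<bullet>\<^sub>c uhat0 m = 0"
    and g: "poly_growth uhat0"
    using w0(2) r poly_growth_of_summable_weighted[of uhat0]
    by (simp_all add: Vk_expansion_def kcheck cvec_scaleR cdot_smult_right cdot_commute[of _ "cvec a"])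
  have g': "poly_growth d" "poly_growth e"
    unfolding d_def e_def by (rule poly_growth_deriv[OF g])+
  have gb: "poly_growth b"
    unfolding b_def
  proof (rule poly_growth_smult[OF g, where D = "1 / r" and j = 0])
    fix m :: int assume "m \<in> Zstar"
    then have "1 \<le> \<bar>real_of_int m\<bar>" by simp
    then show "norm (\<i> / (of_int m * complex_of_real r)) \<le> 1 / r * \<bar>real_of_int m\<bar> ^ 0"
      using r by (simp add: norm_divide norm_mult divide_simps)
  qed
  have dd: "(\<lambda>m. (\<i> * of_int m) *s d m) = e"
  proof -
    have "(\<i> * of_int m) * (\<i> * of_int m) = - (of_int m :: complex)\<^sup>2" for m
      by (simp only: power2_eq_square[symmetric] power_mult_distrib) simp
    then show ?thesis
      by (simp only: d_def e_def vector_smult_assoc)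
  qed
  have db: "H (\<lambda>m. (\<i> * of_int m) *s b m) z = - (1 / r) *\<^sub>R H uhat0 z" for z
  proof -
    have "H (\<lambda>m. (\<i> * of_int m) *s b m) = H (\<lambda>m. - (1 / r) *\<^sub>R uhat0 m)"
      unfolding H_def by (rule heat_series_cong) (simp add: b_def vec_eq_iff scaleR_conv_of_real[where 'a = complex])
    then show ?thesis
      by (simp only: H_def heat_series_scaleR)
  qed
  have derivU: "(U has_vector_derivative - \<Omega> *\<^sub>R (J *v U t)) (at t)" for t
    unfolding U by (rule rotation_has_vector_derivative)
  have contU: "continuous_on UNIV U"
    by (intro continuous_at_imp_continuous_on ballI has_vector_derivative_continuous[OF derivU])
  interpret w: transverse_wave \<Omega> r a U V "\<lambda>z. cvec_Re (H uhat0 z)" "\<lambda>z. cvec_Re (H d z)" "\<lambda>z. cvec_Re (H e z)"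
    "\<lambda>z. cvec_Re (H (\<lambda>m. (- (of_int m)\<^sup>2) *s d m) z)" "\<lambda>z. cvec_Re (H b z)"
    "\<lambda>z. cvec_Re (H (\<lambda>m. (- (of_int m)\<^sup>2) *s b m) z)" pstar
  proof
    show "0 < r" "norm a = 1" by fact+
    show "(U has_vector_derivative - \<Omega> *\<^sub>R (J *v U t)) (at t)" for t
      by (rule derivU)
    fix s t :: real assume t: "0 < t"
    show "(V has_vector_derivative U t) (at t)"
      unfolding V by (rule integral_from_0_has_vector_derivative[OF contU t])
    show "((\<lambda>z. cvec_Re (H uhat0 z)) has_derivative
        (\<lambda>h. fst h *\<^sub>R cvec_Re (H d (s, t)) + (r\<^sup>2 * snd h) *\<^sub>R cvec_Re (H e (s, t)))) (at (s, t))"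
      unfolding H_def d_def e_def by (rule has_derivative_cvec_Re_heat_series[OF r(2) t g])
    show "((\<lambda>z. cvec_Re (H d z)) has_derivative
        (\<lambda>h. fst h *\<^sub>R cvec_Re (H e (s, t))
          + (r\<^sup>2 * snd h) *\<^sub>R cvec_Re (H (\<lambda>m. (- (of_int m)\<^sup>2) *s d m) (s, t)))) (at (s, t))"
      unfolding H_def dd[symmetric] by (rule has_derivative_cvec_Re_heat_series[OF r(2) t g'(1)])
    show "((\<lambda>z. cvec_Re (H b z)) has_derivative
        (\<lambda>h. fst h *\<^sub>R (- (1 / r) *\<^sub>R cvec_Re (H uhat0 (s, t)))
          + (r\<^sup>2 * snd h) *\<^sub>R cvec_Re (H (\<lambda>m. (- (of_int m)\<^sup>2) *s b m) (s, t)))) (at (s, t))"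
    proof -
      have "- (1 / r) *\<^sub>R cvec_Re (H uhat0 (s, t)) = cvec_Re (H (\<lambda>m. (\<i> * of_int m) *s b m) (s, t))"
        unfolding db by (rule linear_simps(5)[OF bounded_linear_cvec_Re, symmetric])
      then show ?thesis
        unfolding H_def using has_derivative_cvec_Re_heat_series[OF r(2) t gb] by (simp only:)
    qed
    \<comment> \<open>The divergence-free condition makes each term orthogonal to \<open>a\<close>;
      boundedness of the bilinear pairing passes this to the sum.\<close>
    have "((\<lambda>m. cvec a \<bullet>\<^sub>c (heat_mode (r\<^sup>2) m (s, t) *s uhat0 m)) has_sum cvec a \<bullet>\<^sub>c H uhat0 (s, t)) Zstar"
      unfolding H_def
      by (rule has_sum_bounded_linear[OF bounded_linear_cdot_right heat_series_has_sum[OF r(2) t g]])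
    then have "((\<lambda>m. 0) has_sum cvec a \<bullet>\<^sub>c H uhat0 (s, t)) Zstar"
      by (subst (asm) has_sum_cong[where g = "\<lambda>m. 0"]) (simp_all add: cdot_smult_right orth)
    then have "cvec a \<bullet>\<^sub>c H uhat0 (s, t) = 0"
      by (rule has_sum_unique) (simp add: has_sum_0)
    then show "a \<bullet> cvec_Re (H uhat0 (s, t)) = 0"
      by (simp add: inner_cvec_Re)
  next
    show "continuous_on (UNIV \<times> {0<..}) (\<lambda>z. cvec_Re (H e z))"
      unfolding H_def
      by (auto intro!: continuous_at_imp_continuous_on
          has_derivative_continuous[OF has_derivative_cvec_Re_heat_series[OF r(2) _ g'(2)]])
  qed

  define phase where "phase = (\<lambda>x t. w.K \<bullet> (x - V t))"
  \<comment> \<open>Decay, moving-phase factor and plane wave combine into one heat mode with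
    diffusivity r^2 at the phase K . (x - V(t)).\<close>
  have mode: "exp (- complex_of_real ((real_of_int m)\<^sup>2 * r\<^sup>2 * t))
           * exp (- \<i> * of_int m * complex_of_real (kcheck L k \<bullet> V t)) * wave L k m x
      = heat_mode (r\<^sup>2) m (phase x t, t)" for m x t
    unfolding wave_def heat_mode_def phase_def w.K_def kcheck[symmetric] exp_add[symmetric]
    by (rule arg_cong[where f = exp]) (simp add: inner_diff_right algebra_simps)
  have sum_u: "((\<lambda>m. u_mode m x t) has_sum
      cvec (rot a (w.\<omega> * t) (w.at_phase (\<lambda>z. cvec_Re (H uhat0 z)) x t))) Zstar" if t: "0 < t" for x t
  proof -
    let ?A = "map_matrix complex_of_real (Ek L k (- (ktilde L k $ 3) * \<Omega> * t))"
    have "((\<lambda>m. ?A *v (heat_mode (r\<^sup>2) m (phase x t, t) *s uhat0 m)) has_sum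
        ?A *v H uhat0 (phase x t, t)) Zstar"
      unfolding H_def
      by (rule has_sum_bounded_linear[OF matrix_vector_mul_bounded_linear heat_series_has_sum[OF r(2) t g]])
    \<comment> \<open>Once the series is known to be real, the complexified matrix acts on it as the
      real rotation.\<close>
    moreover have real_H: "H uhat0 (phase x t, t) = cvec (cvec_Re (H uhat0 (phase x t, t)))"
      unfolding H_def by (rule cvec_cvec_Re[symmetric, OF cvec_cnj_heat_series[OF r(2) t g real]])
    have "?A *v H uhat0 (phase x t, t) = cvec (rot a (w.\<omega> * t) (w.at_phase (\<lambda>z. cvec_Re (H uhat0 z)) x t))"
      by (subst real_H) (simp only: map_matrix_vector_mult_cvec Ek_vector_mult a_def[symmetric] w.\<omega>_def w.at_phase_def phase_def)
    moreover have "u_mode m x t = ?A *v (heat_mode (r\<^sup>2) m (phase x t, t) *s uhat0 m)" for m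
      unfolding u_mode r_def[symmetric] mode by (simp add: vector_scalar_commute)
    ultimately show ?thesis
      by (simp only:)
  qed
  have sum_p: "((\<lambda>m. p_mode m x t) has_sum
      complex_of_real (w.pdir t \<bullet> w.at_phase (\<lambda>z. cvec_Re (H b z)) x t)) Zstar" if t: "0 < t" for x t
  proof -
    have "((\<lambda>m. cvec (w.pdir t) \<bullet>\<^sub>c (heat_mode (r\<^sup>2) m (phase x t, t) *s b m)) has_sum
        cvec (w.pdir t) \<bullet>\<^sub>c H b (phase x t, t)) Zstar"
      unfolding H_def
      by (rule has_sum_bounded_linear[OF bounded_linear_cdot_right heat_series_has_sum[OF r(2) t gb]])
    \<comment> \<open>The factor i/(m r) is conjugated when \<open>m\<close> changes sign, so the
      pressure coefficients inherit the reality condition.\<close>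
    moreover have "b (- m) = cvec_cnj (b m)" if "m \<in> Zstar" for m
      using real[OF that] by (simp add: b_def cvec_cnj_smult)
    then have real_H: "H b (phase x t, t) = cvec (cvec_Re (H b (phase x t, t)))"
      unfolding H_def by (rule cvec_cvec_Re[symmetric, OF cvec_cnj_heat_series[OF r(2) t gb]])
    have "cvec (w.pdir t) \<bullet>\<^sub>c H b (phase x t, t) = complex_of_real (w.pdir t \<bullet> w.at_phase (\<lambda>z. cvec_Re (H b z)) x t)"
      by (subst real_H) (simp only: cdot_cvec w.at_phase_def phase_def)
    moreover have "p_mode m x t = cvec (w.pdir t) \<bullet>\<^sub>c (heat_mode (r\<^sup>2) m (phase x t, t) *s b m)" for m
      unfolding p_mode r_def[symmetric] mode[symmetric] b_def w.pdir_def a_def[symmetric] cdot_smult_right by (simp only: mult_ac)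
    ultimately show ?thesis
      by (simp only:)
  qed
  have u_eq: "u x t = cvec (w.velocity x t)" and p_eq: "p x t = complex_of_real (w.pressure x t)"
    if "0 < t" for x t
    using infsumI[OF sum_u[OF that]] infsumI[OF sum_p[OF that]]
    by (simp_all add: u p w.velocity_def w.pressure_def cvec_add)
  have "classical_solution \<Omega> (\<lambda>x t. cvec_Re (u x t)) (\<lambda>x t. Re (p x t))"
    by (rule classical_solution_cong[OF w.classical_solution]) (simp_all add: u_eq p_eq)
  moreover have "(\<lambda>m. u_mode m x t) summable_on Zstar" "(\<lambda>m. p_mode m x t) summable_on Zstar"
    if "0 < t" for x t
    using sum_u[OF that] sum_p[OF that] by (auto simp: summable_on_def)
  ultimately show ?thesis
    by (simp add: u_eq p_eq)
qed

end
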